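(* Let $X$ be a compact Hausdorff space and let $\mathscr{C}(X)$ be the ring of continuous functions $X\to\mathbb{R}$, endowed with the topology of the maximum norm. Let $\Omega\subseteq\mathscr{C}(X)$ and $\Sigma\subsetneq\Omega$. Let $(\Sigma)$ be the ideal of $\mathscr{C}(X)$ generated by $\Sigma$ and assume that $$\sqrt[J]{(\Sigma)}\cap\Omega=\Sigma,$$ where $\sqrt[J]{\cdot}$ denotes the Jacobson radical. If $\Omega\setminus\Sigma$ is quasi-compact in $\mathscr{C}(X)$ (i.e. every open covering has a finite sub-covering), then there is a finite length correct test sequence for $\Omega$ with respect to $\Sigma$. In particular, if $\Sigma=\{0\}$ and $\Omega\setminus\{0\}$ is quasi-compact, then there is a correct test sequence of finite length for $\Omega$ or, equivalently, $\Omega$ has a finite norming set.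
   Context: The Jacobson radical of an ideal is the intersection of all maximal ideals containing it (the whole ring if there are none). A finite set $\mathbf{Q}=\{x_1,\ldots,x_L\}\subseteq X$ is a correct test sequence of length $L$ for $\Omega$ with respect to $\Sigma$ if for every $f\in\Omega$: $f(x_1)=\cdots=f(x_L)=0$ implies $f\in\Sigma$. When $\Sigma=\{0\}\subsetneq\Omega$ one says "correct test sequence for $\Omega$". A finite set $\mathbf{Q}=\{x_1,\ldots,x_L\}\subseteq X$ is a finite norming set for $\Omega$ if $\|f\|:=\max\{|f(x_i)|:1\le i\le L\}$ is a norm on $\Omega$ in the following wide sense ($\Omega$ need not be a subspace): $\|f\|\ge0$; $\|f\|=0$ iff $f=0$ for $f\in\Omega$; $\|f+g\|\le\|f\|+\|g\|$ whenever $f,g,f+g\in\Omega$; $\|\lambda f\|\le|\lambda|\,\|f\|$ whenever $f,\lambda f\in\Omega$. *)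

theory Defs
  imports "HOL-Analysis.Analysis" "HOL-Algebra.Ideal"
begin

text \<open>
  The ring of continuous functions on \<open>X\<close>, with pointwise operations.  As for the
  library's metric spaces of functions, a function on \<open>topspace X\<close> is represented by an
  extensional one (it is \<open>undefined\<close> outside \<open>topspace X\<close>), so that equality of elements is
  equality of functions on \<open>X\<close>.
\<close>

definition cont_ring :: "'a topology \<Rightarrow> ('a \<Rightarrow> real) ring"
  where "cont_ring X =
    \<lparr> carrier = {f \<in> extensional (topspace X). continuous_map X euclideanreal f},
      monoid.mult = (\<lambda>f g. restrict (\<lambda>x. f x * g x) (topspace X)),
      one = restrict (\<lambda>x. 1) (topspace X),
      zero = restrict (\<lambda>x. 0) (topspace X),
      add = (\<lambda>f g. restrict (\<lambda>x. f x + g x) (topspace X)) \<rparr>"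

definition cont_scale :: "'a topology \<Rightarrow> real \<Rightarrow> ('a \<Rightarrow> real) \<Rightarrow> 'a \<Rightarrow> real"
  where "cont_scale X c f = restrict (\<lambda>x. c * f x) (topspace X)"

text \<open>
  The topology of the maximum norm.  The library metric \<open>cfunspace X euclidean_metric\<close> is
  the supremum distance on the bounded continuous functions on \<open>X\<close>; for compact \<open>X\<close> its
  points are all the elements of the ring (lemma \<open>topspace_maxnorm_topology\<close>).
\<close>

definition maxnorm_topology :: "'a topology \<Rightarrow> ('a \<Rightarrow> real) topology"
  where "maxnorm_topology X = mtopology_of (cfunspace X euclidean_metric)"

text \<open>The intersection with the carrier matters only if no maximal ideal contains \<open>I\<close>.\<close>

definition jacobson_radical :: "('b, 'm) ring_scheme \<Rightarrow> 'b set \<Rightarrow> 'b set"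
  where "jacobson_radical R I = carrier R \<inter> \<Inter>{M. maximalideal M R \<and> I \<subseteq> M}"

text \<open>The length of a correct test sequence \<open>Q\<close> is \<open>card Q\<close>.\<close>

definition correct_test_sequence ::
    "'a topology \<Rightarrow> ('a \<Rightarrow> real) set \<Rightarrow> ('a \<Rightarrow> real) set \<Rightarrow> 'a set \<Rightarrow> bool"
  where "correct_test_sequence X \<Omega> \<Sigma> Q \<longleftrightarrow>
    finite Q \<and> Q \<subseteq> topspace X \<and> (\<forall>f\<in>\<Omega>. (\<forall>x\<in>Q. f x = 0) \<longrightarrow> f \<in> \<Sigma>)"

definition max_abs_on :: "'a set \<Rightarrow> ('a \<Rightarrow> real) \<Rightarrow> real"
  where "max_abs_on Q f = Max ((\<lambda>x. \<bar>f x\<bar>) ` Q)"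

text \<open>
  \<open>Q\<close> is required to be nonempty because the maximum over the empty set is not defined.
\<close>

definition finite_norming_set ::
    "'a topology \<Rightarrow> ('a \<Rightarrow> real) set \<Rightarrow> 'a set \<Rightarrow> bool"
  where "finite_norming_set X \<Omega> Q \<longleftrightarrow>
    finite Q \<and> Q \<noteq> {} \<and> Q \<subseteq> topspace X \<and>
    (\<forall>f\<in>\<Omega>. 0 \<le> max_abs_on Q f) \<and>
    (\<forall>f\<in>\<Omega>. max_abs_on Q f = 0 \<longleftrightarrow> f = \<zero>\<^bsub>cont_ring X\<^esub>) \<and>
    (\<forall>f\<in>\<Omega>. \<forall>g\<in>\<Omega>. f \<oplus>\<^bsub>cont_ring X\<^esub> g \<in> \<Omega> \<longrightarrow>
        max_abs_on Q (f \<oplus>\<^bsub>cont_ring X\<^esub> g) \<le> max_abs_on Q f + max_abs_on Q g) \<and>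
    (\<forall>c. \<forall>f\<in>\<Omega>. cont_scale X c f \<in> \<Omega> \<longrightarrow>
        max_abs_on Q (cont_scale X c f) \<le> \<bar>c\<bar> * max_abs_on Q f)"

lemma cring_cont_ring: "cring (cont_ring X)"
proof (rule cringI)
  show "abelian_group (cont_ring X)"
  proof (rule abelian_groupI)
    fix f assume f: "f \<in> carrier (cont_ring X)"
    show "\<exists>g\<in>carrier (cont_ring X). g \<oplus>\<^bsub>cont_ring X\<^esub> f = \<zero>\<^bsub>cont_ring X\<^esub>"
      by (rule bexI[of _ "restrict (\<lambda>x. - f x) (topspace X)"])
         (use f in \<open>auto simp: cont_ring_def fun_eq_iff intro!: continuous_map_eq[where g = "restrict _ _"]
            intro: continuous_map_minus\<close>)
  qed (auto simp: cont_ring_def fun_eq_iff extensional_def intro!: continuous_map_add continuous_map_eq[where g = "restrict _ _"])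
  show "comm_monoid (cont_ring X)"
    by (rule comm_monoidI)
       (auto simp: cont_ring_def fun_eq_iff extensional_def intro!: continuous_map_real_mult continuous_map_eq[where g = "restrict _ _"])
qed (auto simp: cont_ring_def fun_eq_iff algebra_simps)

lemma topspace_maxnorm_topology:
  assumes "compact_space X"
  shows "topspace (maxnorm_topology X) = carrier (cont_ring X)"
  using assms unfolding compact_space_def
  by (auto simp: maxnorm_topology_def cont_ring_def compactin_mspace_cfunspace
      simp del: mspace_cfunspace)

lemma mdist_maxnorm:
  assumes "compact_space X" "topspace X \<noteq> {}"
    and "f \<in> carrier (cont_ring X)" "g \<in> carrier (cont_ring X)"
  shows "mdist (cfunspace X euclidean_metric) f g = (SUP x\<in>topspace X. \<bar>f x - g x\<bar>)"
proof -
  have "f \<in> mspace (cfunspace X euclidean_metric)" "g \<in> mspace (cfunspace X euclidean_metric)"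
    using topspace_maxnorm_topology[OF assms(1)] assms(3,4)
    by (auto simp: maxnorm_topology_def simp del: mspace_cfunspace)
  then show ?thesis
    using assms(2)
    by (simp add: mdist_cfunspace_eq_mdist_funspace Met_TC.fdist_def
        Met_TC.fspace_def dist_real_def)
qed

end

theory Submission
  imports Defs
begin

text \<open>
  A function that does not vanish identically is nonzero at some point \<open>x\<close>, and it remains
  nonzero at \<open>x\<close> under small perturbations in the maximum norm, because evaluation at a
  point is continuous (\<open>continuous_map_evaluation\<close>).  The sets \<open>{f. f x \<noteq> 0}\<close> are therefore
  open, and together they cover every set of nonzero functions.  For a compact set finitely
  many of them suffice, and the corresponding points detect each of its members
  (\<open>compact_nonzero_functions_detected\<close>).

  The radical condition enters through the zero function: it lies in every ideal, hence in
  the Jacobson radical, so if it belongs to \<open>\<Omega>\<close> it belongs to \<open>\<Sigma>\<close>.  Thus \<open>\<Omega> - \<Sigma>\<close> consists of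
  nonzero functions, and a finite set of points that detects all of them is exactly a
  correct test sequence.

  The maximum of \<open>\<bar>f\<bar>\<close> over a nonempty finite set \<open>Q\<close> is always a seminorm.  Its kernel
  consists of the functions that vanish on \<open>Q\<close>, so it is a norm on \<open>\<Omega>\<close> precisely if \<open>Q\<close>
  is a correct test sequence for \<open>\<Omega>\<close> with respect to \<open>{0}\<close>.
\<close>

text \<open>
  The distance of two functions bounds their difference at each point, so evaluation is
  Lipschitz with constant 1.
\<close>

lemma continuous_map_evaluation:
  assumes x: "x \<in> topspace X"
  shows "continuous_map (maxnorm_topology X) euclideanreal (\<lambda>f. f x)"
proof -
  let ?m = "cfunspace X (euclidean_metric :: real metric)"
  have "dist (f x) (g x) \<le> mdist ?m f g" if fg: "f \<in> mspace ?m" "g \<in> mspace ?m" for f g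
    using mdist_cfunspace_imp_mdist_le[OF fg order_refl x] by simp
  then have "Lipschitz_continuous_map ?m euclidean_metric (\<lambda>f. f x)"
    by (auto simp: Lipschitz_continuous_map_def simp del: mspace_cfunspace intro!: exI[of _ 1])
  then show ?thesis
    using Lipschitz_continuous_imp_continuous_map by (fastforce simp: maxnorm_topology_def)
qed

lemma nonzero_in_cont_ring:
  assumes "f \<in> carrier (cont_ring X)"
  shows "f \<noteq> \<zero>\<^bsub>cont_ring X\<^esub> \<longleftrightarrow> (\<exists>x\<in>topspace X. f x \<noteq> 0)"
  using assms by (auto simp: cont_ring_def fun_eq_iff extensional_def)

lemma compact_nonzero_functions_detected:
  assumes "compact_space X" and K: "compactin (maxnorm_topology X) K"
    and nz: "\<zero>\<^bsub>cont_ring X\<^esub> \<notin> K"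
  obtains Q where "finite Q" "Q \<subseteq> topspace X" "\<forall>f\<in>K. \<exists>x\<in>Q. f x \<noteq> 0"
proof -
  define U where "U x = {f \<in> topspace (maxnorm_topology X). f x \<noteq> 0}" for x
  have op: "openin (maxnorm_topology X) (U x)" if "x \<in> topspace X" for x
    using openin_continuous_map_preimage[OF continuous_map_evaluation[OF that], of "- {0}"]
    by (simp add: U_def open_Compl)
  have Ksub: "K \<subseteq> topspace (maxnorm_topology X)"
    using K by (rule compactin_subset_topspace)
  have cov: "K \<subseteq> \<Union>(U ` topspace X)"
  proof
    fix f assume f: "f \<in> K"
    with Ksub have "f \<in> carrier (cont_ring X)"
      using topspace_maxnorm_topology[OF assms(1)] by auto
    moreover have "f \<noteq> \<zero>\<^bsub>cont_ring X\<^esub>" using f nz by auto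
    ultimately obtain x where "x \<in> topspace X" "f x \<noteq> 0"
      using nonzero_in_cont_ring by blast
    then show "f \<in> \<Union>(U ` topspace X)"
      using f Ksub by (auto simp: U_def)
  qed
  obtain \<F> where \<F>: "finite \<F>" "\<F> \<subseteq> U ` topspace X" "K \<subseteq> \<Union>\<F>"
    using compactinD[OF K _ cov] op by blast
  then obtain Q where "finite Q" "Q \<subseteq> topspace X" "\<F> = U ` Q"
    using finite_subset_image by metis
  with \<F>(3) show thesis
    by (intro that[of Q]) (auto simp: U_def)
qed

lemma zero_in_jacobson_radical:
  assumes "ring R"
  shows "\<zero>\<^bsub>R\<^esub> \<in> jacobson_radical R I"
proof -
  interpret ring R by fact
  show ?thesis
    unfolding jacobson_radical_def
    by (auto intro!: additive_subgroup.zero_closed ideal.axioms(1) maximalideal.axioms(1))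
qed

lemma max_abs_on_eq_0_iff:
  assumes "finite Q" "Q \<noteq> {}"
  shows "max_abs_on Q f = 0 \<longleftrightarrow> (\<forall>x\<in>Q. f x = 0)"
  using assms by (auto simp: max_abs_on_def Max_eq_iff image_iff)

lemma abs_le_max_abs_on:
  assumes "finite Q" "x \<in> Q"
  shows "\<bar>f x\<bar> \<le> max_abs_on Q f"
  using assms by (auto simp: max_abs_on_def)

lemma max_abs_on_leI:
  assumes "finite Q" "Q \<noteq> {}" "\<And>x. x \<in> Q \<Longrightarrow> \<bar>f x\<bar> \<le> B"
  shows "max_abs_on Q f \<le> B"
  using assms by (auto simp: max_abs_on_def)

text \<open>
  The remaining norm axioms hold for the maximum of absolute values over any nonempty finite
  set of points, so definiteness on \<open>\<Omega>\<close> decides.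
\<close>

lemma finite_norming_set_iff:
  "finite_norming_set X \<Omega> Q \<longleftrightarrow>
    finite Q \<and> Q \<noteq> {} \<and> Q \<subseteq> topspace X \<and>
    (\<forall>f\<in>\<Omega>. (\<forall>x\<in>Q. f x = 0) \<longleftrightarrow> f = \<zero>\<^bsub>cont_ring X\<^esub>)"
proof (cases "finite Q \<and> Q \<noteq> {} \<and> Q \<subseteq> topspace X")
  case True
  then have Q: "finite Q" "Q \<noteq> {}" "Q \<subseteq> topspace X" by auto
  have nonneg: "0 \<le> max_abs_on Q f" for f
    using Q abs_le_max_abs_on by (metis abs_ge_zero all_not_in_conv order_trans)
  have add: "max_abs_on Q (f \<oplus>\<^bsub>cont_ring X\<^esub> g) \<le> max_abs_on Q f + max_abs_on Q g" for f g
  proof (rule max_abs_on_leI[OF Q(1,2)])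
    fix x assume x: "x \<in> Q"
    then have "(f \<oplus>\<^bsub>cont_ring X\<^esub> g) x = f x + g x"
      using Q(3) by (auto simp: cont_ring_def)
    then show "\<bar>(f \<oplus>\<^bsub>cont_ring X\<^esub> g) x\<bar> \<le> max_abs_on Q f + max_abs_on Q g"
      using abs_le_max_abs_on[OF Q(1) x, of f] abs_le_max_abs_on[OF Q(1) x, of g] by linarith
  qed
  have scale: "max_abs_on Q (cont_scale X c f) \<le> \<bar>c\<bar> * max_abs_on Q f" for c f
  proof (rule max_abs_on_leI[OF Q(1,2)])
    fix x assume x: "x \<in> Q"
    then have "\<bar>cont_scale X c f x\<bar> = \<bar>c\<bar> * \<bar>f x\<bar>"
      using Q(3) by (auto simp: cont_scale_def abs_mult)
    then show "\<bar>cont_scale X c f x\<bar> \<le> \<bar>c\<bar> * max_abs_on Q f"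
      using abs_le_max_abs_on[OF Q(1) x, of f] by (simp add: mult_left_mono)
  qed
  show ?thesis
    using Q nonneg add scale by (simp add: finite_norming_set_def max_abs_on_eq_0_iff)
qed (auto simp: finite_norming_set_def)

text \<open>
  A proper subset \<open>{0} \<subset> \<Omega>\<close> leaves a nonzero function to be detected, so a correct test
  sequence is nonempty, as a norming set must be.
\<close>

lemma correct_test_sequence_iff_finite_norming_set:
  assumes "{\<zero>\<^bsub>cont_ring X\<^esub>} \<subset> \<Omega>"
  shows "correct_test_sequence X \<Omega> {\<zero>\<^bsub>cont_ring X\<^esub>} Q \<longleftrightarrow> finite_norming_set X \<Omega> Q"
proof -
  have "Q \<noteq> {}" if "correct_test_sequence X \<Omega> {\<zero>\<^bsub>cont_ring X\<^esub>} Q"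
    using that assms by (auto simp: correct_test_sequence_def)
  moreover have "\<zero>\<^bsub>cont_ring X\<^esub> x = 0" if "x \<in> topspace X" for x
    using that by (simp add: cont_ring_def)
  ultimately show ?thesis
    unfolding finite_norming_set_iff by (auto simp: correct_test_sequence_def subset_iff)
qed

theorem proposition4p6:
  fixes X :: "'a topology" and \<Omega> \<Sigma> :: "('a \<Rightarrow> real) set"
  assumes "compact_space X" and "Hausdorff_space X"
    and "\<Omega> \<subseteq> carrier (cont_ring X)" and "\<Sigma> \<subset> \<Omega>"
    and "compactin (maxnorm_topology X) (\<Omega> - \<Sigma>)"
  shows "(jacobson_radical (cont_ring X) (Idl\<^bsub>cont_ring X\<^esub> \<Sigma>) \<inter> \<Omega> = \<Sigma> \<longrightarrow>
           (\<exists>Q. correct_test_sequence X \<Omega> \<Sigma> Q)) \<and>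
         (\<Sigma> = {\<zero>\<^bsub>cont_ring X\<^esub>} \<longrightarrow>
           (\<exists>Q. correct_test_sequence X \<Omega> \<Sigma> Q) \<and>
           (\<exists>Q. finite_norming_set X \<Omega> Q) \<and>
           (\<forall>Q. correct_test_sequence X \<Omega> \<Sigma> Q \<longleftrightarrow> finite_norming_set X \<Omega> Q))"
proof -
  have ex: "\<exists>Q. correct_test_sequence X \<Omega> \<Sigma> Q" if "\<zero>\<^bsub>cont_ring X\<^esub> \<notin> \<Omega> - \<Sigma>"
    using compact_nonzero_functions_detected[OF assms(1,5) that]
    unfolding correct_test_sequence_def by (metis DiffI)
  have "\<exists>Q. correct_test_sequence X \<Omega> \<Sigma> Q"
    if "jacobson_radical (cont_ring X) (Idl\<^bsub>cont_ring X\<^esub> \<Sigma>) \<inter> \<Omega> = \<Sigma>"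
    using ex that zero_in_jacobson_radical[OF cring.axioms(1)[OF cring_cont_ring]] by blast
  moreover have "(\<exists>Q. correct_test_sequence X \<Omega> \<Sigma> Q) \<and> (\<exists>Q. finite_norming_set X \<Omega> Q) \<and>
      (\<forall>Q. correct_test_sequence X \<Omega> \<Sigma> Q \<longleftrightarrow> finite_norming_set X \<Omega> Q)"
    if "\<Sigma> = {\<zero>\<^bsub>cont_ring X\<^esub>}"
    using ex that assms(4) correct_test_sequence_iff_finite_norming_set by blast
  ultimately show ?thesis by blast
qed

end
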